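(* Let $d\ge 2$ and $N>d$ be integers such that $d$ divides $N$. Then the cross-join graph $\mathcal{C}(N,d)$ of the generalized de Bruijn digraph $G_B(N,d)$ is connected.
   Context: For integers $d\ge2$ and $N>d$, the generalized de Bruijn digraph $G_B(N,d)$ has vertex set $V=\{0,1,\ldots,N-1\}$, and $(x,y)$ is an edge iff $y\equiv dx+r \pmod N$ for some $r\in\{0,1,\ldots,d-1\}$; then $y$ is a successor of $x$ and $x$ a predecessor of $y$. A de Bruijn cycle is a Hamiltonian cycle of $G_B(N,d)$ (a cycle visiting every vertex exactly once). Two distinct vertices $x_1,x_2$ are conjugate if there exist two distinct vertices $y_1,y_2$ such that $(x_1,y_1),(x_1,y_2),(x_2,y_1),(x_2,y_2)$ are all edges. A cross-join operation on a de Bruijn cycle $u$: choose a conjugate pair $x_1,x_2$ on $u$ and interchange their successors on $u$ (i.e. replace the edges $x_1\to y_1$, $x_2\to y_2$ of $u$ by $x_1\to y_2$, $x_2\to y_1$), which splits $u$ into two disjoint cycles; then choose a conjugate pair $z_1,z_2$ with $z_1$ on one of these cycles and $z_2$ on the other and interchange their successors, obtaining a new Hamiltonian cycle. Two de Bruijn cycles are (cross-join) adjacent if one can be obtained from the other by a single cross-join operation. The cross-join graph $\mathcal{C}(N,d)$ is the graph whose vertices are all de Bruijn cycles of $G_B(N,d)$, with an edge between two of them iff they are adjacent. *)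

theory Defs
  imports "Graph_Theory.Graph_Theory" "HOL-Number_Theory.Cong"
begin

definition gen_de_bruijn :: "nat \<Rightarrow> nat \<Rightarrow> nat pair_pre_digraph" where
  "gen_de_bruijn N d =
     \<lparr> pverts = {0..<N},
       parcs = {(x, y). x \<in> {0..<N} \<and> y \<in> {0..<N} \<and> (\<exists>r\<in>{0..<d}. [y = d * x + r] (mod N))} \<rparr>"

text \<open>
  A directed cycle is represented by its set of arcs, which identifies closed walks that differ
  only in their starting vertex. Loops count as cycles (the library's
  \<^const>\<open>pre_digraph.cycle\<close> allows length 1): interchanging successors on a Hamiltonian cycle
  may split off a loop such as \<open>0 \<rightarrow> 0\<close>.
\<close>

definition cycle_arcs :: "'a pair_pre_digraph \<Rightarrow> ('a \<times> 'a) set \<Rightarrow> bool" where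
  "cycle_arcs G C \<longleftrightarrow> (\<exists>p. pre_digraph.cycle (with_proj G) p \<and> C = set p)"

text \<open>The tails of the arcs of a cycle are exactly the vertices that it visits.\<close>

definition hamiltonian_cycle_arcs :: "'a pair_pre_digraph \<Rightarrow> ('a \<times> 'a) set \<Rightarrow> bool" where
  "hamiltonian_cycle_arcs G C \<longleftrightarrow> cycle_arcs G C \<and> fst ` C = pverts G"

definition conjugate :: "'a pair_pre_digraph \<Rightarrow> 'a \<Rightarrow> 'a \<Rightarrow> bool" where
  "conjugate G x1 x2 \<longleftrightarrow> x1 \<in> pverts G \<and> x2 \<in> pverts G \<and> x1 \<noteq> x2 \<and>
     (\<exists>y1\<in>pverts G. \<exists>y2\<in>pverts G. y1 \<noteq> y2 \<and>
        {(x1, y1), (x1, y2), (x2, y1), (x2, y2)} \<subseteq> parcs G)"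

text \<open>Intended for \<open>(x1, y1)\<close> and \<open>(x2, y2)\<close> in \<open>C\<close>.\<close>

definition interchange :: "('a \<times> 'a) set \<Rightarrow> 'a \<Rightarrow> 'a \<Rightarrow> 'a \<Rightarrow> 'a \<Rightarrow> ('a \<times> 'a) set" where
  "interchange C x1 y1 x2 y2 = (C - {(x1, y1), (x2, y2)}) \<union> {(x1, y2), (x2, y1)}"

text \<open>
  For arbitrary \<open>N\<close> and \<open>d\<close> conjugate vertices need not have all their successors in common, so
  it is part of the definition that the two intermediate cycles and the resulting Hamiltonian
  cycle lie in the digraph. Choosing for \<open>z1, z2\<close> the pair \<open>x1, x2\<close> again would merely undo the
  first interchange; the condition \<open>u' \<noteq> u\<close> (the result is a new cycle) excludes this.
\<close>

definition cross_join :: "'a pair_pre_digraph \<Rightarrow> ('a \<times> 'a) set \<Rightarrow> ('a \<times> 'a) set \<Rightarrow> bool" where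
  "cross_join G u u' \<longleftrightarrow>
     hamiltonian_cycle_arcs G u \<and> hamiltonian_cycle_arcs G u' \<and> u' \<noteq> u \<and>
     (\<exists>x1 y1 x2 y2 C1 C2 z1 w1 z2 w2.
        conjugate G x1 x2 \<and> (x1, y1) \<in> u \<and> (x2, y2) \<in> u \<and>
        cycle_arcs G C1 \<and> cycle_arcs G C2 \<and> fst ` C1 \<inter> fst ` C2 = {} \<and>
        interchange u x1 y1 x2 y2 = C1 \<union> C2 \<and>
        conjugate G z1 z2 \<and> (z1, w1) \<in> C1 \<and> (z2, w2) \<in> C2 \<and>
        u' = interchange (C1 \<union> C2) z1 w1 z2 w2)"

text \<open>Undirected graphs are symmetric digraphs, following the convention of the graph library.\<close>

definition cross_join_graph :: "nat \<Rightarrow> nat \<Rightarrow> (nat \<times> nat) set pair_pre_digraph" where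
  "cross_join_graph N d =
     \<lparr> pverts = {u. hamiltonian_cycle_arcs (gen_de_bruijn N d) u},
       parcs = {(u, v). cross_join (gen_de_bruijn N d) u v \<or> cross_join (gen_de_bruijn N d) v u} \<rparr>"

lemma finite_pverts_cross_join_graph: "finite (pverts (cross_join_graph N d))"
proof (rule finite_subset)
  show "pverts (cross_join_graph N d) \<subseteq> Pow ({0..<N} \<times> {0..<N})"
    by (auto simp: cross_join_graph_def hamiltonian_cycle_arcs_def cycle_arcs_def
        pre_digraph.cycle_def pre_digraph.awalk_def gen_de_bruijn_def dest!: subsetD)
qed simp

lemma pair_graph_cross_join_graph: "pair_graph (cross_join_graph N d)"
proof -
  let ?G = "cross_join_graph N d"
  have sub: "parcs ?G \<subseteq> pverts ?G \<times> pverts ?G"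
    by (auto simp: cross_join_graph_def cross_join_def)
  have "finite (parcs ?G)"
    using sub finite_pverts_cross_join_graph by (meson finite_SigmaI finite_subset)
  moreover have "sym (parcs ?G)"
    by (auto simp: cross_join_graph_def sym_def)
  moreover have "fst e \<noteq> snd e" if "e \<in> parcs ?G" for e
    using that by (auto simp: cross_join_graph_def cross_join_def)
  ultimately show ?thesis
    using sub finite_pverts_cross_join_graph
    by unfold_locales (auto simp: symmetric_def)
qed

end

theory Submission
  imports Defs "HOL-Combinatorics.Orbits"
begin

text \<open>
  Since \<open>d\<close> divides \<open>N\<close>, two vertices with a common successor have the same successors. Hence
  composing a cyclic permutation along the arcs with a transposition of two such vertices again
  yields a permutation along the arcs.

  Given Hamiltonian cycles \<open>f \<noteq> h\<close>, pick \<open>a\<close> with \<open>f a \<noteq> h a\<close> and let \<open>f b = h a\<close>. Then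
  \<open>k = f \<circ> (a b)\<close> has two orbits. As \<open>h\<close> is cyclic, it maps some \<open>c\<close> in the orbit of \<open>a\<close> to a
  point outside of it; with \<open>k e = h c\<close>, the permutation \<open>k \<circ> (c e)\<close> is cyclic again. It agrees with
  \<open>h\<close> wherever \<open>f\<close> did, and also at \<open>a\<close>, so iterating this cross-join leads from \<open>f\<close> to \<open>h\<close>.
  A Hamiltonian cycle exists because an orbit of maximal size is closed under successors.
\<close>

section \<open>Orbits of a permutation composed with a transposition\<close>

lemma orbit_subset_if_closed:
  assumes "\<And>y. y \<in> T \<Longrightarrow> f y \<in> T" "x \<in> T"
  shows "orbit f x \<subseteq> T"
proof
  fix y assume "y \<in> orbit f x"
  then show "y \<in> T" by induct (use assms in auto)
qed

lemma permutation_comp_transpose: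
  assumes "permutation f"
  shows "permutation (f \<circ> transpose a b)"
  using assms by (simp add: permutation_compose permutation_swap_id)

text \<open>The map \<open>f \<circ> transpose a b\<close> sends \<open>a\<close> to
  \<open>f b\<close>, follows \<open>f\<close> from there until it first meets \<open>a\<close>, and
  so closes up without ever passing through \<open>b\<close>.\<close>

lemma orbit_comp_transpose_disjoint:
  assumes f: "permutation f" and b: "a \<in> orbit f b" "a \<noteq> b"
  shows "orbit (f \<circ> transpose a b) a \<inter> orbit (f \<circ> transpose a b) b = {}"
proof -
  let ?g = "f \<circ> transpose a b"
  define k where "k = (LEAST n. 0 < n \<and> (f ^^ n) b = a)"
  have ex: "\<exists>n. 0 < n \<and> (f ^^ n) b = a"
    using b(1) by (auto simp: orbit_altdef)
  have k: "0 < k" "(f ^^ k) b = a"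
    using LeastI_ex[OF ex] by (auto simp: k_def)
  have least: "k \<le> n" if "0 < n" "(f ^^ n) b = a" for n
    using that unfolding k_def by (simp add: Least_le)
  define T where "T = {(f ^^ n) b | n. 0 < n \<and> n \<le> k}"
  \<comment> \<open>A return to \<open>b\<close> after \<open>n\<close> steps would bring the first
    visit to \<open>a\<close> forward to time \<open>k - n\<close>, against the minimality of
    \<open>k\<close>.\<close>
  have not_b: "(f ^^ n) b \<noteq> b" if n: "0 < n" "n \<le> k" for n
  proof
    assume eq: "(f ^^ n) b = b"
    then have "n \<noteq> k" using k b(2) by auto
    then have "0 < k - n" using n by simp
    moreover have "(f ^^ (k - n)) b = a"
      using k(2) eq n funpow_add[of "k - n" n f] by simp
    ultimately show False using least[of "k - n"] n by simp
  qed
  have "?g y \<in> T" if "y \<in> T" for y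
  proof -
    obtain n where n: "y = (f ^^ n) b" "0 < n" "n \<le> k"
      using \<open>y \<in> T\<close> unfolding T_def by blast
    show ?thesis
    proof (cases "n = k")
      case True
      then have "?g y = (f ^^ 1) b" using n k by simp
      then show ?thesis using k(1) unfolding T_def by fastforce
    next
      case False
      then have "y \<noteq> a" using n least[of n] by auto
      moreover have "y \<noteq> b" using n not_b by auto
      ultimately have "?g y = (f ^^ Suc n) b" using n by simp
      moreover have "Suc n \<le> k" using n False by simp
      ultimately show ?thesis unfolding T_def by blast
    qed
  qed
  moreover have "a \<in> T" unfolding T_def using k by blast
  ultimately have "orbit ?g a \<subseteq> T" by (rule orbit_subset_if_closed)
  moreover have "b \<notin> T"
  proof
    assume "b \<in> T"
    then obtain n where "b = (f ^^ n) b" "0 < n" "n \<le> k" unfolding T_def by blast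
    then show False using not_b[of n] by simp
  qed
  ultimately have "b \<notin> orbit ?g a" by blast
  then show ?thesis
    using permutation_self_in_orbit[OF permutation_comp_transpose[OF f, of a b]]
    by (meson disjoint_iff orbit_swap orbit_trans)
qed

text \<open>Both \<open>a\<close> and \<open>b\<close> lie in the union, so the transposition
  preserves it. The union is therefore closed under \<open>f\<close> itself and contains the whole
  \<open>f\<close>-orbit of \<open>a\<close>.\<close>

lemma orbit_comp_transpose_Un:
  assumes f: "permutation f" and S: "cyclic_on f S" "a \<in> S" "b \<in> S"
  shows "orbit (f \<circ> transpose a b) a \<union> orbit (f \<circ> transpose a b) b = S"
proof -
  let ?g = "f \<circ> transpose a b"
  let ?U = "orbit ?g a \<union> orbit ?g b"
  have self: "y \<in> orbit ?g y" for y
    by (rule permutation_self_in_orbit[OF permutation_comp_transpose[OF f]])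
  have "orbit ?g y \<subseteq> S" if "y \<in> S" for y
    using that S by (intro orbit_subset_if_closed) (auto intro: cyclic_on_inI simp: transpose_def)
  then have "?U \<subseteq> S" using S by simp
  moreover have "f y \<in> ?U" if "y \<in> ?U" for y
  proof -
    have "transpose a b y \<in> ?U" using that self by (auto simp: transpose_def)
    then have "?g (transpose a b y) \<in> ?U" by (auto intro: orbit.step simp del: comp_apply)
    then show ?thesis by simp
  qed
  then have "orbit f a \<subseteq> ?U" by (rule orbit_subset_if_closed) (use self in auto)
  then have "S \<subseteq> ?U" using S orbit_cyclic_eq3 by metis
  ultimately show ?thesis by blast
qed

text \<open>The new map leads from \<open>a\<close> to \<open>f b\<close> and then runs through
  \<open>B\<close> along \<open>f\<close> until it reaches \<open>b\<close>. Once both points are in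
  one orbit, that orbit is closed under \<open>f\<close> and absorbs \<open>A\<close> and
  \<open>B\<close>.\<close>

lemma cyclic_on_comp_transpose_Un:
  assumes f: "permutation f" and A: "cyclic_on f A" "a \<in> A" and B: "cyclic_on f B" "b \<in> B"
    and disj: "A \<inter> B = {}"
  shows "cyclic_on (f \<circ> transpose a b) (A \<union> B)"
proof -
  let ?g = "f \<circ> transpose a b"
  let ?U = "orbit ?g a"
  have self: "a \<in> ?U"
    by (rule permutation_self_in_orbit[OF permutation_comp_transpose[OF f]])
  have "?U \<subseteq> A \<union> B"
    using A B by (intro orbit_subset_if_closed) (auto intro: cyclic_on_inI simp: transpose_def)
  have b: "b \<in> ?U"
  proof (rule ccontr)
    assume nb: "b \<notin> ?U"
    \<comment> \<open>Such a \<open>y\<close> is neither \<open>b\<close>, which is assumed to lie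
      outside \<open>?U\<close>, nor \<open>a\<close>, which lies in \<open>A\<close>; hence the
      transposition does not affect it.\<close>
    have "f y \<in> ?U \<inter> B" if "y \<in> ?U \<inter> B" for y
    proof -
      have "?g y = f y" using that nb A disj by (auto simp: transpose_def)
      then show ?thesis using that orbit.step[of y ?g a] cyclic_on_inI[OF B(1)] by auto
    qed
    moreover have "f b \<in> ?U \<inter> B" using orbit.base[of ?g a] B cyclic_on_inI by auto
    ultimately have "orbit f (f b) \<subseteq> ?U \<inter> B" by (rule orbit_subset_if_closed)
    then show False using nb B orbit_cyclic_eq3[OF B(1) cyclic_on_inI[OF B]] by auto
  qed
  have "f y \<in> ?U" if "y \<in> ?U" for y
  proof -
    have "transpose a b y \<in> ?U" using that self b by (auto simp: transpose_def)
    then have "?g (transpose a b y) \<in> ?U" by (rule orbit.step)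
    then show ?thesis by simp
  qed
  then have "orbit f y \<subseteq> ?U" if "y \<in> ?U" for y using that by (rule orbit_subset_if_closed)
  then have "A \<subseteq> ?U" "B \<subseteq> ?U" using self b A B orbit_cyclic_eq3 by metis+
  with \<open>?U \<subseteq> A \<union> B\<close> have "A \<union> B = ?U" by blast
  with self show ?thesis by (metis cyclic_on_singleI)
qed

section \<open>Arc sets of cycles as graphs of cyclic permutations\<close>

abbreviation graph_on :: "('a \<Rightarrow> 'b) \<Rightarrow> 'a set \<Rightarrow> ('a \<times> 'b) set" where
  "graph_on f S \<equiv> (\<lambda>x. (x, f x)) ` S"

text \<open>Turns the surgery on arc sets into composition with a transposition, to which the orbit
  lemmas apply.\<close>

lemma interchange_graph_on:
  assumes "inj f" "a \<in> S" "b \<in> S" "a \<noteq> b"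
  shows "interchange (graph_on f S) a (f a) b (f b) = graph_on (f \<circ> transpose a b) S"
  using assms by (auto simp: interchange_def transpose_def image_iff inj_eq split: if_splits)

lemma cas_map_with_proj:
  "pre_digraph.cas (with_proj G) u p v \<Longrightarrow> map fst p @ [v] = u # map snd p"
  by (induction p arbitrary: u) (auto simp: pre_digraph.cas.simps)

lemma awalk_verts_with_proj:
  "pre_digraph.cas (with_proj G) u p v \<Longrightarrow> pre_digraph.awalk_verts (with_proj G) u p = u # map snd p"
  by (induction p arbitrary: u) (auto simp: pre_digraph.cas.simps pre_digraph.awalk_verts.simps)

lemma cas_with_proj_fst_subset:
  assumes "pre_digraph.cas (with_proj G) u p v" "u \<in> T" "\<And>a b. (a, b) \<in> set p \<Longrightarrow> a \<in> T \<Longrightarrow> b \<in> T"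
  shows "fst ` set p \<subseteq> T"
  using assms
proof (induction p arbitrary: u)
  case (Cons e p)
  obtain a b where e: "e = (a, b)" by fastforce
  have "a \<in> T" using Cons.prems e by (simp add: pre_digraph.cas.simps)
  moreover have "fst ` set p \<subseteq> T"
  proof (rule Cons.IH)
    show "pre_digraph.cas (with_proj G) b p v" using Cons.prems(1) e by (simp add: pre_digraph.cas.simps)
    show "b \<in> T" using Cons.prems(3)[of a b] e \<open>a \<in> T\<close> by simp
    show "d \<in> T" if "(c, d) \<in> set p" "c \<in> T" for c d using Cons.prems(3)[of c d] that by simp
  qed
  ultimately show ?case using e by simp
qed simp

text \<open>The required closed walk iterates \<open>f\<close> from a point \<open>s\<close> until
  the first return to \<open>s\<close>; up to then all iterates are distinct.\<close>

lemma cycle_arcs_graph_on: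
  assumes f: "cyclic_on f S" and S: "S \<subseteq> pverts G" "graph_on f S \<subseteq> parcs G"
  shows "cycle_arcs G (graph_on f S)"
proof -
  obtain s where s: "s \<in> S" "S = orbit f s" using f by (auto simp: cyclic_on_def)
  then have s': "s \<in> orbit f s" by simp
  obtain n where n: "(f ^^ n) s = s" "0 < n" "inj_on (\<lambda>i. (f ^^ i) s) {0..<n}"
    using funpow_dist1_prop[OF s'] inj_on_funpow_dist1[OF s'] by blast
  define p where "p = map (\<lambda>i. ((f ^^ i) s, (f ^^ Suc i) s)) [0..<n]"
  have cas: "pre_digraph.cas (with_proj G) ((f ^^ i) s)
      (map (\<lambda>i. ((f ^^ i) s, (f ^^ Suc i) s)) [i..<i + m]) ((f ^^ (i + m)) s)" for i m
  proof (induction m arbitrary: i)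
    case (Suc m)
    have "[i..<i + Suc m] = i # [Suc i..<Suc i + m]" by (simp add: upt_rec)
    then show ?case using Suc[of "Suc i"] by (simp add: pre_digraph.cas.simps)
  qed (simp add: pre_digraph.cas.simps)
  have cas_p: "pre_digraph.cas (with_proj G) s p s"
    using cas[of 0 n] n unfolding p_def by simp
  have "S = (\<lambda>i. (f ^^ i) s) ` {0..<n}"
    using orbit_altdef_bounded[OF n(1,2)] s by auto
  then have set_p: "set p = graph_on f S"
    by (auto simp: p_def image_image)
  have "p \<noteq> []" using n by (simp add: p_def)
  have "distinct (map fst p)" using n(3) by (simp add: p_def distinct_map comp_def inj_on_def)
  \<comment> \<open>Tails and heads of a closed walk form the same multiset, so distinctness passes
    from the tails to the heads, which is where \<open>cycle\<close> asks for it.\<close>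
  moreover have "mset (map fst p) = mset (map snd p)"
    using arg_cong[OF cas_map_with_proj[OF cas_p], of mset] by simp
  ultimately have "distinct (map snd p)" using mset_eq_imp_distinct_iff by blast
  then have "pre_digraph.cycle (with_proj G) p"
    unfolding pre_digraph.cycle_def pre_digraph.awalk_def
    using cas_p \<open>p \<noteq> []\<close> set_p S s by (auto simp: awalk_verts_with_proj intro!: exI[of _ s])
  then show ?thesis using set_p unfolding cycle_arcs_def by auto
qed

text \<open>No tail repeats on a cycle, so its arc list is the table of a successor map. This map is
  a bijection of the visited vertices, and it is cyclic because a single closed walk meets them
  all.\<close>

lemma cycle_arcs_obtain_graph_on:
  assumes "cycle_arcs G C"
  obtains f where "f permutes fst ` C" "cyclic_on f (fst ` C)" "C = graph_on f (fst ` C)"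
proof -
  obtain p u where C: "C = set p" and cas: "pre_digraph.cas (with_proj G) u p u"
    and dist: "distinct (tl (pre_digraph.awalk_verts (with_proj G) u p))" and "p \<noteq> []"
    using assms unfolding cycle_arcs_def pre_digraph.cycle_def pre_digraph.awalk_def by blast
  have mset: "mset (map fst p) = mset (map snd p)"
    using arg_cong[OF cas_map_with_proj[OF cas], of mset] by simp
  have dist_snd: "distinct (map snd p)" using dist by (simp add: awalk_verts_with_proj[OF cas])
  then have dist_fst: "distinct (map fst p)" using mset mset_eq_imp_distinct_iff by blast
  define S where "S = fst ` C"
  \<comment> \<open>The identity outside \<open>S\<close> is what \<open>permutes\<close>
    requires.\<close>
  define f where "f x = (if x \<in> S then the (map_of p x) else x)" for x
  have f: "f a = b" if "(a, b) \<in> C" for a b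
    using that dist_fst by (force simp: f_def C S_def)
  have Cf: "C = graph_on f S" using f unfolding S_def by force
  have "f ` S = snd ` C" unfolding Cf by force
  moreover have "snd ` C = S" using mset_eq_setD[OF mset] by (simp add: C S_def)
  moreover have "inj_on f S"
  proof (rule inj_onI)
    fix x y assume "x \<in> S" "y \<in> S" "f x = f y"
    then have "(x, f x) \<in> set p" "(y, f x) \<in> set p" using Cf C by auto
    then show "x = y"
      using dist_snd inj_onD[of snd "set p" "(x, f x)" "(y, f x)"] by (simp add: distinct_map)
  qed
  ultimately have perm: "f permutes S"
    by (intro bij_imp_permutes) (auto simp: bij_betw_def f_def)
  have "finite S" by (simp add: S_def C)
  have "u \<in> S" using cas \<open>p \<noteq> []\<close> by (cases p) (auto simp: pre_digraph.cas.simps S_def C)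
  have self: "u \<in> orbit f u"
    using perm \<open>finite S\<close> by (metis permutation_permutes permutation_self_in_orbit)
  have "fst ` set p \<subseteq> orbit f u"
    by (rule cas_with_proj_fst_subset[OF cas self]) (use f C in \<open>auto intro: orbit.step\<close>)
  then have "S = orbit f u" using permutes_orbit_subset[OF perm \<open>u \<in> S\<close>] by (auto simp: S_def C)
  then have "cyclic_on f S" using self by (metis cyclic_on_singleI)
  with perm Cf show thesis using that unfolding S_def by blast
qed

section \<open>One-factors, cross-joins and Hamiltonian cycles in line digraphs\<close>

text \<open>
  The last assumption says that vertices with a common successor have all their successors in
  common (Heuchenne's condition, which characterises line digraphs).
\<close>

locale line_digraph =
  fixes G :: "'a pair_pre_digraph"
  assumes finite_verts: "finite (pverts G)"
    and arcs_subset: "parcs G \<subseteq> pverts G \<times> pverts G"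
    and common_succ: "(a, y) \<in> parcs G \<Longrightarrow> (b, y) \<in> parcs G \<Longrightarrow> (a, z) \<in> parcs G \<Longrightarrow> (b, z) \<in> parcs G"
begin

text \<open>A 1-factor is a spanning family of disjoint cycles. Since \<open>permutes\<close> fixes
  everything outside the vertex set, two different one-factors differ at some vertex.\<close>

definition one_factor :: "('a \<Rightarrow> 'a) \<Rightarrow> bool" where
  "one_factor f \<longleftrightarrow> f permutes pverts G \<and> graph_on f (pverts G) \<subseteq> parcs G"

lemma one_factor_arc: "one_factor f \<Longrightarrow> x \<in> pverts G \<Longrightarrow> (x, f x) \<in> parcs G"
  by (auto simp: one_factor_def)

lemma one_factor_permutation: "one_factor f \<Longrightarrow> permutation f"
  using finite_verts by (auto simp: one_factor_def permutation_permutes)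

lemma one_factor_in_verts: "one_factor f \<Longrightarrow> f x \<in> pverts G \<longleftrightarrow> x \<in> pverts G"
  by (simp add: one_factor_def permutes_in_image)

text \<open>The vertex \<open>f b\<close> is a common successor of \<open>a\<close> and
  \<open>b\<close>; hence \<open>b\<close> also has an arc to \<open>f a\<close>, and both exchanged
  arcs exist.\<close>

lemma one_factor_comp_transpose:
  assumes f: "one_factor f" and a: "(a, f b) \<in> parcs G"
  shows "one_factor (f \<circ> transpose a b)"
proof -
  have v: "a \<in> pverts G" "b \<in> pverts G"
    using a arcs_subset one_factor_in_verts[OF f] by auto
  have "(b, f a) \<in> parcs G" using common_succ a one_factor_arc[OF f] v by metis
  then have "(x, (f \<circ> transpose a b) x) \<in> parcs G" if "x \<in> pverts G" for x
    using a that one_factor_arc[OF f] by (auto simp: transpose_def)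
  moreover have "f \<circ> transpose a b permutes pverts G"
    using f v by (intro permutes_compose permutes_swap_id) (auto simp: one_factor_def)
  ultimately show ?thesis by (auto simp: one_factor_def)
qed

lemma conjugate_one_factor:
  assumes f: "one_factor f" and a: "(a, f b) \<in> parcs G" and "a \<noteq> b"
  shows "conjugate G a b"
proof -
  have v: "a \<in> pverts G" "b \<in> pverts G"
    using a arcs_subset one_factor_in_verts[OF f] by auto
  have "(b, f a) \<in> parcs G" using common_succ a one_factor_arc[OF f] v by metis
  moreover have "f a \<noteq> f b"
    using f \<open>a \<noteq> b\<close> by (auto simp: one_factor_def dest: permutes_inj injD)
  ultimately show ?thesis
    using a v \<open>a \<noteq> b\<close> one_factor_arc[OF f] one_factor_in_verts[OF f]
    unfolding conjugate_def by blast
qed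

text \<open>Allows Hamiltonian cycles to be handled as cyclic one-factors, that is, as
  permutations.\<close>

lemma hamiltonian_cycle_arcs_iff:
  "hamiltonian_cycle_arcs G u \<longleftrightarrow>
    (\<exists>f. one_factor f \<and> cyclic_on f (pverts G) \<and> u = graph_on f (pverts G))"
proof
  assume u: "hamiltonian_cycle_arcs G u"
  then obtain f where "f permutes fst ` u" "cyclic_on f (fst ` u)" "u = graph_on f (fst ` u)"
    unfolding hamiltonian_cycle_arcs_def using cycle_arcs_obtain_graph_on by blast
  moreover have "u \<subseteq> parcs G"
    using u by (auto simp: hamiltonian_cycle_arcs_def cycle_arcs_def pre_digraph.cycle_def
        pre_digraph.awalk_def)
  ultimately show "\<exists>f. one_factor f \<and> cyclic_on f (pverts G) \<and> u = graph_on f (pverts G)"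
    using u unfolding hamiltonian_cycle_arcs_def one_factor_def by metis
next
  assume "\<exists>f. one_factor f \<and> cyclic_on f (pverts G) \<and> u = graph_on f (pverts G)"
  then show "hamiltonian_cycle_arcs G u"
    by (auto simp: hamiltonian_cycle_arcs_def one_factor_def image_image intro: cycle_arcs_graph_on)
qed

lemma cross_join_towards:
  assumes f: "one_factor f" "cyclic_on f (pverts G)"
    and h: "one_factor h" "cyclic_on h (pverts G)"
    and "f \<noteq> h"
  obtains g where "one_factor g" "cyclic_on g (pverts G)"
    "cross_join G (graph_on f (pverts G)) (graph_on g (pverts G))"
    "{x \<in> pverts G. g x \<noteq> h x} \<subset> {x \<in> pverts G. f x \<noteq> h x}"
proof -
  let ?V = "pverts G"
  have f_inj: "inj f" and h_inj: "inj h" using f h by (auto simp: one_factor_def permutes_inj)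
  obtain a where fa: "f a \<noteq> h a" using \<open>f \<noteq> h\<close> by auto
  then have a: "a \<in> ?V" using f h by (metis one_factor_def permutes_not_in)
  obtain b where fb: "f b = h a" using f by (metis one_factor_def permutes_surj surjD)
  have b: "b \<in> ?V" using a fb one_factor_in_verts f h by metis
  have "a \<noteq> b" using fa fb by auto
  have ab: "(a, f b) \<in> parcs G" using fb one_factor_arc[OF h(1) a] by simp
  define k where "k = f \<circ> transpose a b"
  have k: "one_factor k" unfolding k_def using f(1) ab by (rule one_factor_comp_transpose)
  have k_perm: "permutation k" using k by (rule one_factor_permutation)
  have k_inj: "inj k" using k by (auto simp: one_factor_def permutes_inj)
  have "a \<in> orbit f b" using f(2) a b by (simp add: orbit_cyclic_eq3)
  then have disj: "orbit k a \<inter> orbit k b = {}"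
    unfolding k_def using one_factor_permutation[OF f(1)] \<open>a \<noteq> b\<close>
    by (intro orbit_comp_transpose_disjoint)
  have Un: "orbit k a \<union> orbit k b = ?V"
    unfolding k_def using one_factor_permutation[OF f(1)] f(2) a b
    by (intro orbit_comp_transpose_Un)
  have self: "x \<in> orbit k x" for x using k_perm by (rule permutation_self_in_orbit)
  have cyc: "cyclic_on k (orbit k x)" for x using k_perm by (rule cyclic_on_orbit')
  \<comment> \<open>Otherwise the \<open>h\<close>-orbit of \<open>a\<close>, which is the whole
    vertex set, would stay inside \<open>orbit k a\<close> and miss \<open>b\<close>.\<close>
  have "\<exists>c \<in> orbit k a. h c \<notin> orbit k a"
  proof (rule ccontr)
    assume "\<not> ?thesis"
    then have "orbit h a \<subseteq> orbit k a" using self by (intro orbit_subset_if_closed) auto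
    then have "b \<in> orbit k a" using orbit_cyclic_eq3[OF h(2) a] b by auto
    then show False using disj self by blast
  qed
  then obtain c where c: "c \<in> orbit k a" "h c \<notin> orbit k a" by blast
  have cV: "c \<in> ?V" using c Un by auto
  obtain e where ke: "k e = h c" using k by (metis one_factor_def permutes_surj surjD)
  have "e \<in> ?V" using cV ke one_factor_in_verts k h by metis
  moreover have "e \<notin> orbit k a" using ke c(2) orbit.step by metis
  ultimately have e: "e \<in> orbit k b" using Un by blast
  have "c \<noteq> e" using c(1) \<open>e \<notin> orbit k a\<close> by auto
  have ce: "(c, k e) \<in> parcs G" using ke one_factor_arc[OF h(1) cV] by simp
  define g where "g = k \<circ> transpose c e"
  have g: "one_factor g" unfolding g_def using k ce by (rule one_factor_comp_transpose)
  have g_cyc: "cyclic_on g ?V"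
    unfolding g_def Un[symmetric] using k_perm cyc c(1) cyc e disj
    by (rule cyclic_on_comp_transpose_Un)
  have kc: "k c \<noteq> h c" using c orbit.step by metis
  \<comment> \<open>Agreement with \<open>h\<close> survives because the transpositions move only
    points of disagreement: \<open>a\<close> and \<open>c\<close> by choice, \<open>b\<close> and
    \<open>e\<close> because \<open>h\<close> is injective and already takes the values
    \<open>f b\<close> at \<open>a\<close> and \<open>k e\<close> at \<open>c\<close>.\<close>
  have agree: "g x = h x" if "f x = h x" for x
  proof -
    have "x \<noteq> a" using that fa by auto
    moreover have "x \<noteq> b" using that fb inj_eq[OF h_inj] \<open>a \<noteq> b\<close> by metis
    ultimately have kx: "k x = h x" using that by (simp add: k_def)
    then have "x \<noteq> c" using kc by auto
    moreover have "x \<noteq> e" using kx ke inj_eq[OF h_inj] \<open>c \<noteq> e\<close> by metis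
    ultimately show ?thesis using kx by (simp add: g_def)
  qed
  \<comment> \<open>The second transposition leaves \<open>a\<close> alone, so \<open>a\<close>
    becomes a new point of agreement and the inclusion is strict.\<close>
  have "k a = h a" using fb by (simp add: k_def)
  then have "a \<noteq> c" using kc by auto
  moreover have "a \<noteq> e" using \<open>e \<notin> orbit k a\<close> self by auto
  ultimately have ga: "g a = h a" using \<open>k a = h a\<close> by (simp add: g_def)
  have "{x \<in> ?V. g x \<noteq> h x} \<subset> {x \<in> ?V. f x \<noteq> h x}"
    using agree ga fa a by blast
  moreover have "cross_join G (graph_on f ?V) (graph_on g ?V)"
    unfolding cross_join_def
  proof (intro conjI exI)
    show "hamiltonian_cycle_arcs G (graph_on f ?V)" "hamiltonian_cycle_arcs G (graph_on g ?V)"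
      using f g g_cyc hamiltonian_cycle_arcs_iff by blast+
    show "graph_on g ?V \<noteq> graph_on f ?V" using a ga fa by force
    show "conjugate G a b" using f(1) ab \<open>a \<noteq> b\<close> by (rule conjugate_one_factor)
    show "conjugate G c e" using k ce \<open>c \<noteq> e\<close> by (rule conjugate_one_factor)
    show "(a, f a) \<in> graph_on f ?V" "(b, f b) \<in> graph_on f ?V" using a b by auto
    show "cycle_arcs G (graph_on k (orbit k a))" "cycle_arcs G (graph_on k (orbit k b))"
      using Un cyc one_factor_arc[OF k] by (auto intro!: cycle_arcs_graph_on)
    show "fst ` graph_on k (orbit k a) \<inter> fst ` graph_on k (orbit k b) = {}"
      using disj by (simp add: image_image)
    show "interchange (graph_on f ?V) a (f a) b (f b) =
        graph_on k (orbit k a) \<union> graph_on k (orbit k b)"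
      using interchange_graph_on[OF f_inj a b \<open>a \<noteq> b\<close>] Un by (simp add: k_def flip: image_Un)
    show "(c, k c) \<in> graph_on k (orbit k a)" "(e, k e) \<in> graph_on k (orbit k b)"
      using c e by auto
    show "graph_on g ?V =
        interchange (graph_on k (orbit k a) \<union> graph_on k (orbit k b)) c (k c) e (k e)"
      using interchange_graph_on[OF k_inj cV \<open>e \<in> ?V\<close> \<open>c \<noteq> e\<close>] Un
      by (simp add: g_def flip: image_Un)
  qed
  ultimately show thesis using that g g_cyc by blast
qed

text \<open>Descent on the number of vertices at which the current cycle and the target
  \<open>h\<close> disagree.\<close>

lemma cross_join_rtrancl:
  assumes "one_factor f" "cyclic_on f (pverts G)" "one_factor h" "cyclic_on h (pverts G)"
  shows "(cross_join G)\<^sup>*\<^sup>* (graph_on f (pverts G)) (graph_on h (pverts G))"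
  using assms
proof (induction "card {x \<in> pverts G. f x \<noteq> h x}" arbitrary: f rule: less_induct)
  case less
  show ?case
  proof (cases "f = h")
    case False
    obtain g where g: "one_factor g" "cyclic_on g (pverts G)"
      and cj: "cross_join G (graph_on f (pverts G)) (graph_on g (pverts G))"
      and sub: "{x \<in> pverts G. g x \<noteq> h x} \<subset> {x \<in> pverts G. f x \<noteq> h x}"
      using cross_join_towards[OF less.prems False] by blast
    have "card {x \<in> pverts G. g x \<noteq> h x} < card {x \<in> pverts G. f x \<noteq> h x}"
      using finite_verts sub by (intro psubset_card_mono) auto
    then have "(cross_join G)\<^sup>*\<^sup>* (graph_on g (pverts G)) (graph_on h (pverts G))"
      using less g by blast
    with cj show ?thesis by (rule converse_rtranclp_into_rtranclp)
  qed simp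
qed

text \<open>Among all one-factors, take one whose orbit of \<open>v\<close> is largest. An arc from
  \<open>a\<close> in this orbit to a vertex \<open>f b\<close> outside it would allow a
  transposition of \<open>a\<close> and \<open>b\<close> that merges two orbits into a larger one.
  So the orbit is closed under successors, and \<open>succ_closed\<close> makes it
  everything.\<close>

lemma cyclic_one_factor_exists:
  assumes "one_factor f0" "v \<in> pverts G"
    and succ_closed: "\<And>T. v \<in> T \<Longrightarrow> T \<subseteq> pverts G \<Longrightarrow>
      (\<And>x y. x \<in> T \<Longrightarrow> (x, y) \<in> parcs G \<Longrightarrow> y \<in> T) \<Longrightarrow> T = pverts G"
  obtains f where "one_factor f" "cyclic_on f (pverts G)"
proof -
  have sub: "orbit f v \<subseteq> pverts G" if "one_factor f" for f
    using that assms(2) by (auto simp: one_factor_def dest: permutes_orbit_subset)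
  have "\<exists>f. one_factor f \<and> (\<forall>g. one_factor g \<longrightarrow> card (orbit g v) \<le> card (orbit f v))"
    using assms(1) sub finite_verts
    by (intro ex_has_greatest_nat[where b = "Suc (card (pverts G))"])
      (auto intro: card_mono simp: less_Suc_eq_le)
  then obtain f where f: "one_factor f"
    and max: "\<And>g. one_factor g \<Longrightarrow> card (orbit g v) \<le> card (orbit f v)" by blast
  have perm: "permutation f" using f by (rule one_factor_permutation)
  have self: "x \<in> orbit f x" for x using perm by (rule permutation_self_in_orbit)
  have cyc: "cyclic_on f (orbit f x)" for x using perm by (rule cyclic_on_orbit')
  have "orbit f v = pverts G"
  proof (rule succ_closed)
    show "v \<in> orbit f v" by (rule self)
    show "orbit f v \<subseteq> pverts G" using f by (rule sub)
    fix a y assume a: "a \<in> orbit f v" and ay: "(a, y) \<in> parcs G"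
    show "y \<in> orbit f v"
    proof (rule ccontr)
      assume y: "y \<notin> orbit f v"
      obtain b where fb: "f b = y" using f by (metis one_factor_def permutes_surj surjD)
      have b: "b \<notin> orbit f v" using fb y orbit.step by metis
      then have disj: "orbit f v \<inter> orbit f b = {}"
        using self by (meson disjoint_iff orbit_swap orbit_trans)
      let ?g = "f \<circ> transpose a b"
      have g: "one_factor ?g" using f ay fb by (intro one_factor_comp_transpose) auto
      have "cyclic_on ?g (orbit f v \<union> orbit f b)"
        using perm cyc a cyc self disj by (rule cyclic_on_comp_transpose_Un)
      then have "orbit ?g v = orbit f v \<union> orbit f b"
        using self[of v] by (intro orbit_cyclic_eq3) auto
      then have "orbit f v \<subset> orbit ?g v" using self b by blast
      moreover have "finite (orbit ?g v)" using sub[OF g] finite_verts by (rule finite_subset)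
      ultimately have "card (orbit f v) < card (orbit ?g v)" by (intro psubset_card_mono)
      then show False using max[OF g] by simp
    qed
  qed
  then show thesis using that f cyc by metis
qed

end

section \<open>The generalized de Bruijn digraph when \<open>d\<close> divides
  \<open>N\<close>\<close>

lemma gen_de_bruijn_arc_iff:
  "(x, y) \<in> parcs (gen_de_bruijn N d) \<longleftrightarrow> x < N \<and> y < N \<and> (\<exists>r<d. [y = d * x + r] (mod N))"
  by (auto simp: gen_de_bruijn_def)

text \<open>Reducing modulo \<open>d\<close> shows that a common successor has the same offset from
  \<open>d * a\<close> and from \<open>d * b\<close>. Hence these two are congruent modulo
  \<open>N\<close>, and every offset gives the same successor for both vertices.\<close>

lemma line_digraph_gen_de_bruijn:
  assumes "d dvd N"
  shows "line_digraph (gen_de_bruijn N d)"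
proof
  show "finite (pverts (gen_de_bruijn N d))"
    "parcs (gen_de_bruijn N d) \<subseteq> pverts (gen_de_bruijn N d) \<times> pverts (gen_de_bruijn N d)"
    by (auto simp: gen_de_bruijn_def)
  fix a b y z
  assume ay: "(a, y) \<in> parcs (gen_de_bruijn N d)" and b_y: "(b, y) \<in> parcs (gen_de_bruijn N d)"
    and az: "(a, z) \<in> parcs (gen_de_bruijn N d)"
  obtain r where r: "r < d" "[y = d * a + r] (mod N)" using ay by (auto simp: gen_de_bruijn_arc_iff)
  obtain s where s: "s < d" "[y = d * b + s] (mod N)" using b_y by (auto simp: gen_de_bruijn_arc_iff)
  obtain t where t: "t < d" "[z = d * a + t] (mod N)" using az by (auto simp: gen_de_bruijn_arc_iff)
  have eq: "[d * a + r = d * b + s] (mod N)" using r s by (meson cong_sym cong_trans)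
  then have "[d * a + r = d * b + s] (mod d)" using assms cong_dvd_modulus_nat by blast
  then have "r = s" using r s by (simp add: cong_def)
  then have "[d * a = d * b] (mod N)" using eq by (simp add: cong_add_rcancel_nat)
  then have "[d * a + t = d * b + t] (mod N)" by (simp add: cong_add_rcancel_nat)
  then have "[z = d * b + t] (mod N)" using t cong_trans by blast
  then show "(b, z) \<in> parcs (gen_de_bruijn N d)"
    using t b_y az by (auto simp: gen_de_bruijn_arc_iff)
qed

text \<open>
  After \<open>k\<close> steps from \<open>x\<close> one reaches the residues of the \<open>d ^ k\<close> consecutive numbers starting at
  \<open>d ^ k * x\<close>, which are all residues once \<open>d ^ k \<ge> N\<close>.
\<close>

lemma gen_de_bruijn_succ_closed:
  assumes "2 \<le> d" "x \<in> T" "T \<subseteq> {0..<N}"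
    and closed: "\<And>a b. a \<in> T \<Longrightarrow> (a, b) \<in> parcs (gen_de_bruijn N d) \<Longrightarrow> b \<in> T"
  shows "T = {0..<N}"
proof -
  have N: "0 < N" and "x < N" using assms by auto
  have steps: "(d ^ k * x + r) mod N \<in> T" if "r < d ^ k" for k r
    using that
  proof (induction k arbitrary: r)
    case 0
    then show ?case using assms(2) \<open>x < N\<close> by simp
  next
    case (Suc k)
    let ?a = "d ^ k * x + r div d"
    have "?a mod N \<in> T"
      using Suc by (intro Suc.IH) (simp add: less_mult_imp_div_less mult.commute)
    \<comment> \<open>The last base-\<open>d\<close> digit of \<open>r\<close> is the offset of the
      final arc; the remaining digits describe the first \<open>k\<close> steps.\<close>
    moreover have "d ^ Suc k * x + r = d * ?a + r mod d" by (simp add: algebra_simps)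
    then have "[(d ^ Suc k * x + r) mod N = d * (?a mod N) + r mod d] (mod N)"
      by (simp only: cong_def mod_mod_trivial) (metis mod_add_left_eq mod_mult_right_eq)
    then have "(?a mod N, (d ^ Suc k * x + r) mod N) \<in> parcs (gen_de_bruijn N d)"
      using N assms(1) by (auto simp: gen_de_bruijn_arc_iff intro!: exI[of _ "r mod d"])
    ultimately show ?case by (rule closed)
  qed
  have "y \<in> T" if "y < N" for y
  proof -
    have large: "N < d ^ N" using assms(1) by (simp add: power_gt_expt)
    \<comment> \<open>The residue of \<open>y - d ^ N * x\<close>, written so that the subtraction
      on naturals is not truncated.\<close>
    define r where "r = (y + (N - (d ^ N * x) mod N)) mod N"
    have "r < N" using N by (simp add: r_def)
    then have "r < d ^ N" using large by simp
    moreover have "(d ^ N * x + r) mod N = y"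
    proof -
      have "(d ^ N * x + r) mod N = ((d ^ N * x) mod N + (y + (N - (d ^ N * x) mod N))) mod N"
        unfolding r_def by (metis mod_add_eq mod_mod_trivial)
      also have "(d ^ N * x) mod N + (y + (N - (d ^ N * x) mod N)) = y + N"
        using mod_less_divisor[OF N, of "d ^ N * x"] by linarith
      finally show ?thesis using that by simp
    qed
    ultimately show ?thesis using steps by metis
  qed
  then show ?thesis using assms(3) by auto
qed

text \<open>With \<open>N = d * M\<close>, the perfect shuffle
  \<open>q * M + m \<mapsto> d * m + q\<close> is a bijection. It follows arcs, since
  \<open>d * (q * M + m) + q\<close> differs from its value by the multiple
  \<open>N * q\<close>.\<close>

lemma gen_de_bruijn_one_factor_exists:
  assumes "0 < d" "d dvd N" "0 < N"
  obtains f where "line_digraph.one_factor (gen_de_bruijn N d) f"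
proof -
  interpret line_digraph "gen_de_bruijn N d" using assms(2) by (rule line_digraph_gen_de_bruijn)
  obtain M where M: "N = d * M" using assms(2) by blast
  then have "0 < M" using assms by simp
  define f where "f x = (if x < N then d * (x mod M) + x div M else x)" for x
  have div: "x div M < d" if "x < N" for x using that M by (simp add: less_mult_imp_div_less)
  have lt: "f x < N" if "x < N" for x
  proof -
    have "f x < d * (x mod M) + d" using div that by (simp add: f_def)
    also have "\<dots> = d * Suc (x mod M)" by simp
    also have "\<dots> \<le> d * M" using \<open>0 < M\<close> by (intro mult_le_mono2) (simp add: Suc_leI)
    finally show ?thesis using M by simp
  qed
  have "inj_on f {0..<N}"
  proof (rule inj_onI)
    fix x y assume xy: "x \<in> {0..<N}" "y \<in> {0..<N}" "f x = f y"
    then have eq: "d * (x mod M) + x div M = d * (y mod M) + y div M" by (simp add: f_def)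
    have "x div M < d" "y div M < d" using div xy by auto
    \<comment> \<open>As \<open>x div M < d\<close>, division of \<open>f x\<close> by
      \<open>d\<close> with remainder recovers both parts of \<open>x\<close>.\<close>
    then have "x mod M = y mod M" "x div M = y div M"
      using arg_cong[OF eq, of "\<lambda>n. n div d"] arg_cong[OF eq, of "\<lambda>n. n mod d"] by auto
    then show "x = y" by (metis div_mult_mod_eq)
  qed
  moreover from this have "f ` {0..<N} = {0..<N}" using lt by (intro endo_inj_surj) auto
  ultimately have "f permutes {0..<N}"
    by (intro bij_imp_permutes) (auto simp: bij_betw_def f_def)
  moreover have "(x, f x) \<in> parcs (gen_de_bruijn N d)" if "x < N" for x
  proof -
    have "d * x = d * (x mod M) + N * (x div M)"
      unfolding M by (metis distrib_left mod_mult_div_eq mult.assoc)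
    then have eq: "d * x + x div M = f x + N * (x div M)" using that by (simp add: f_def)
    have "[f x = d * x + x div M] (mod N)" unfolding eq by (simp add: cong_def)
    then show ?thesis using that lt div by (auto simp: gen_de_bruijn_arc_iff)
  qed
  moreover have "pverts (gen_de_bruijn N d) = {0..<N}" by (simp add: gen_de_bruijn_def)
  ultimately have "one_factor f" by (auto simp: one_factor_def)
  then show thesis by (rule that)
qed

section \<open>Connectedness of the cross-join graph\<close>

theorem mainTheorem1:
  fixes N d :: nat
  assumes "2 \<le> d" and "d < N" and "d dvd N"
  shows "connected (with_proj (cross_join_graph N d))"
proof -
  let ?B = "gen_de_bruijn N d"
  let ?X = "cross_join_graph N d"
  interpret line_digraph ?B using assms(3) by (rule line_digraph_gen_de_bruijn)
  interpret X: pair_graph ?X by (rule pair_graph_cross_join_graph)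
  have verts: "pverts ?B = {0..<N}" by (simp add: gen_de_bruijn_def)
  have xverts: "pverts ?X = {u. hamiltonian_cycle_arcs ?B u}" by (simp add: cross_join_graph_def)
  have "0 < d" "0 < N" using assms by auto
  then obtain f0 where f0: "one_factor f0" using gen_de_bruijn_one_factor_exists assms(3) by blast
  \<comment> \<open>Connectedness includes that the graph is nonempty, so some Hamiltonian cycle has
    to be exhibited; the maximal orbit is taken at the vertex 0.\<close>
  obtain f where f: "one_factor f" "cyclic_on f (pverts ?B)"
  proof (rule cyclic_one_factor_exists[OF f0])
    show "0 \<in> pverts ?B" using verts \<open>0 < N\<close> by simp
    fix T assume "0 \<in> T" "T \<subseteq> pverts ?B"
      and "\<And>x y. x \<in> T \<Longrightarrow> (x, y) \<in> parcs ?B \<Longrightarrow> y \<in> T"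
    then show "T = pverts ?B"
      unfolding verts by (rule gen_de_bruijn_succ_closed[OF assms(1)])
  qed
  have reach: "u \<rightarrow>\<^sup>*\<^bsub>with_proj ?X\<^esub> v" if "(cross_join ?B)\<^sup>*\<^sup>* u v" "u \<in> pverts ?X" for u v
    using that
  proof (induction rule: rtranclp_induct)
    case base
    then show ?case by simp
  next
    case (step v w)
    then have adj: "(v, w) \<in> parcs ?X" by (simp add: cross_join_graph_def)
    have "u \<rightarrow>\<^sup>*\<^bsub>with_proj ?X\<^esub> v" using step by simp
    then show ?case using adj by (rule X.reachable_adj_trans)
  qed
  show ?thesis
    unfolding connected_def
  proof (rule strongly_connectedI)
    show "verts (mk_symmetric (with_proj ?X)) \<noteq> {}"
      using f xverts hamiltonian_cycle_arcs_iff by auto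
    fix u v assume "u \<in> verts (mk_symmetric (with_proj ?X))" "v \<in> verts (mk_symmetric (with_proj ?X))"
    then have uv: "u \<in> pverts ?X" "v \<in> pverts ?X" by simp_all
    then have "(cross_join ?B)\<^sup>*\<^sup>* u v"
      by (auto simp: xverts hamiltonian_cycle_arcs_iff intro: cross_join_rtrancl)
    then have "u \<rightarrow>\<^sup>*\<^bsub>with_proj ?X\<^esub> v" using uv(1) by (rule reach)
    then show "u \<rightarrow>\<^sup>*\<^bsub>mk_symmetric (with_proj ?X)\<^esub> v" by (rule X.reachable_mk_symmetricI)
  qed
qed

end
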